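(* Let $\widehat{\mathbf A}$ be a constant symmetric positive definite $3\times3$ matrix and let $\boldsymbol k\in\mathbb{R}^3$ be a constant vector. Put $$S=-\frac{(\widehat{\mathbf A}\boldsymbol M-\boldsymbol M-\boldsymbol k,\boldsymbol\gamma)}{(\widehat{\mathbf A}\boldsymbol\gamma,\boldsymbol\gamma)},\qquad H=\frac12\left((\widehat{\mathbf A}\boldsymbol M,\boldsymbol M)-\frac{(\widehat{\mathbf A}\boldsymbol M-\boldsymbol M-\boldsymbol k,\boldsymbol\gamma)^2}{(\widehat{\mathbf A}\boldsymbol\gamma,\boldsymbol\gamma)}\right),\qquad g=\sqrt{(\widehat{\mathbf A}\boldsymbol\gamma,\boldsymbol\gamma)}.$$ Then the Veselova system with gyrostat, $$\dot{\boldsymbol M}=(\boldsymbol M+\boldsymbol k-S\boldsymbol\gamma)\times\frac{\partial H}{\partial\boldsymbol M}+\boldsymbol\gamma\times\frac{\partial H}{\partial\boldsymbol\gamma},\qquad\dot{\boldsymbol\gamma}=\boldsymbol\gamma\times\frac{\partial H}{\partial\boldsymbol M},$$ is conformally Hamiltonian and integrable: it can be written as $$\dot{\boldsymbol x}=g^{-1}\,\mathbf P_{\boldsymbol k}(\boldsymbol x)\,\frac{\partial H}{\partial\boldsymbol x},\qquad \mathbf P_{\boldsymbol k}=g\begin{pmatrix}\mathbf M_{\boldsymbol k}&\boldsymbol\Gamma\\ \boldsymbol\Gamma&0\end{pmatrix}-gS\begin{pmatrix}\boldsymbol\Gamma&0\\ 0&0\end{pmatrix},$$ where $\mathbf P_{\boldsymbol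 k}$ is a Poisson structure with Casimir functions $F_1=\boldsymbol\gamma^2$ and $F_2=(\boldsymbol M+\boldsymbol k,\boldsymbol\gamma)$, and it admits, besides $H$, the additional first integral $$F_3=(\boldsymbol M+\boldsymbol k,\boldsymbol M+\boldsymbol k).$$
   Context: $(\cdot,\cdot)$ and $\times$ are the standard inner and cross products on $\mathbb{R}^3$; $\boldsymbol x=(\boldsymbol M,\boldsymbol\gamma)\in\mathbb{R}^3\times(\mathbb{R}^3\setminus\{0\})$, the physical case being $\boldsymbol\gamma^2=1$. The blocks are $$\mathbf M_{\boldsymbol k}=\begin{pmatrix}0&-M_3-k_3&M_2+k_2\\ M_3+k_3&0&-M_1-k_1\\ -M_2-k_2&M_1+k_1&0\end{pmatrix},\qquad \boldsymbol\Gamma=\begin{pmatrix}0&-\gamma_3&\gamma_2\\ \gamma_3&0&-\gamma_1\\ -\gamma_2&\gamma_1&0\end{pmatrix}.$$ A skew-symmetric matrix function $\mathbf P(\boldsymbol x)$ is a Poisson structure if the bracket $\{F,G\}=\big(\frac{\partial F}{\partial\boldsymbol x},\mathbf P\frac{\partial G}{\partial\boldsymbol x}\big)$ satisfies the Jacobi identity; a Casimir function is a function $F$ with $\mathbf P\frac{\partial F}{\partial\boldsymbol x}=0$. "Integrable" refers to the existence, on the four-dimensional joint levels of the two Casimir functions, of the first integral $F_3$ in addition to the Hamiltonian $H$. Physically, $\widehat{\mathbf A}$ is the inverse of the inertia tensor, $\boldsymbol k$ is the constant gyrostatic momentum, and the angular velocity is $\boldsymbol\omega=\widehat{\mathbf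 A}(\boldsymbol M+S\boldsymbol\gamma)$, for which $(\boldsymbol M+\boldsymbol k,\boldsymbol\gamma)=(\boldsymbol\omega,\boldsymbol\gamma)$. *)

theory Defs
  imports "HOL-Analysis.Analysis"
begin

unbundle cross3_syntax

definition grad :: "('a::real_inner \<Rightarrow> real) \<Rightarrow> 'a \<Rightarrow> 'a" where
  "grad f x = (THE D. GDERIV f x :> D)"

primrec Ck_on :: "nat \<Rightarrow> 'a::euclidean_space set \<Rightarrow> ('a \<Rightarrow> real) \<Rightarrow> bool" where
  "Ck_on 0 U f \<longleftrightarrow> continuous_on U f"
| "Ck_on (Suc n) U f \<longleftrightarrow>
     (\<exists>D. (\<forall>x\<in>U. GDERIV f x :> D x) \<and> (\<forall>b\<in>Basis. Ck_on n U (\<lambda>x. D x \<bullet> b)))"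

text \<open>The derivatives are taken in the ambient space, so this is meant for open \<open>U\<close>.\<close>

definition smooth_on :: "'a::euclidean_space set \<Rightarrow> ('a \<Rightarrow> real) \<Rightarrow> bool" where
  "smooth_on U f \<longleftrightarrow> (\<forall>n. Ck_on n U f)"

definition bracket ::
    "(real^'n \<Rightarrow> real^'n^'n) \<Rightarrow> (real^'n \<Rightarrow> real) \<Rightarrow> (real^'n \<Rightarrow> real) \<Rightarrow> real^'n \<Rightarrow> real" where
  "bracket P F G x = grad F x \<bullet> (P x *v grad G x)"

definition poisson_structure :: "(real^'n) set \<Rightarrow> (real^'n \<Rightarrow> real^'n^'n) \<Rightarrow> bool" where
  "poisson_structure U P \<longleftrightarrow>
     (\<forall>i j. smooth_on U (\<lambda>x. P x $ i $ j)) \<and>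
     (\<forall>x\<in>U. transpose (P x) = - P x) \<and>
     (\<forall>F G H. smooth_on U F \<longrightarrow> smooth_on U G \<longrightarrow> smooth_on U H \<longrightarrow>
        (\<forall>x\<in>U. bracket P (bracket P F G) H x + bracket P (bracket P G H) F x
                + bracket P (bracket P H F) G x = 0))"

definition casimir ::
    "(real^'n) set \<Rightarrow> (real^'n \<Rightarrow> real^'n^'n) \<Rightarrow> (real^'n \<Rightarrow> real) \<Rightarrow> bool" where
  "casimir U P F \<longleftrightarrow> smooth_on U F \<and> (\<forall>x\<in>U. P x *v grad F x = 0)"

text \<open>If \<open>F\<close> and \<open>G\<close> are independent, their joint levels in an open set \<open>U\<close> are submanifolds
  of codimension two.\<close>

definition independent_functions ::
    "(real^'n) set \<Rightarrow> (real^'n \<Rightarrow> real) \<Rightarrow> (real^'n \<Rightarrow> real) \<Rightarrow> bool" where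
  "independent_functions U F G \<longleftrightarrow>
     (\<forall>x\<in>U. \<forall>a b. a *\<^sub>R grad F x + b *\<^sub>R grad G x = 0 \<longrightarrow> a = 0 \<and> b = 0)"

definition solution_on ::
    "'a::real_normed_vector set \<Rightarrow> ('a \<Rightarrow> 'a) \<Rightarrow> real set \<Rightarrow> (real \<Rightarrow> 'a) \<Rightarrow> bool" where
  "solution_on U v I X \<longleftrightarrow>
     (\<forall>t\<in>I. X t \<in> U \<and> (X has_vector_derivative v (X t)) (at t within I))"

definition first_integral ::
    "'a::euclidean_space set \<Rightarrow> ('a \<Rightarrow> 'a) \<Rightarrow> ('a \<Rightarrow> real) \<Rightarrow> bool" where
  "first_integral U v F \<longleftrightarrow> smooth_on U F \<and>
     (\<forall>I X. is_interval I \<longrightarrow> solution_on U v I X \<longrightarrow> (\<forall>s\<in>I. \<forall>t\<in>I. F (X s) = F (X t)))"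

text \<open>The system \<open>x' = v x\<close> has the form \<open>x' = \<rho>\<^sup>-\<^sup>1 P \<nabla>H\<close> with
  a positive conformal factor \<open>\<rho>\<close> and a Poisson structure \<open>P\<close>.\<close>

definition conformally_hamiltonian ::
    "(real^'n) set \<Rightarrow> (real^'n \<Rightarrow> real^'n) \<Rightarrow> (real^'n \<Rightarrow> real) \<Rightarrow>
     (real^'n \<Rightarrow> real^'n^'n) \<Rightarrow> (real^'n \<Rightarrow> real) \<Rightarrow> bool" where
  "conformally_hamiltonian U v \<rho> P H \<longleftrightarrow>
     smooth_on U \<rho> \<and> (\<forall>x\<in>U. \<rho> x > 0) \<and> poisson_structure U P \<and> smooth_on U H \<and>
     (\<forall>x\<in>U. v x = inverse (\<rho> x) *\<^sub>R (P x *v grad H x))"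

definition join_vec :: "real^'a \<Rightarrow> real^'b \<Rightarrow> real^('a + 'b)" where
  "join_vec u w = (\<chi> i. case i of Inl a \<Rightarrow> u $ a | Inr b \<Rightarrow> w $ b)"

definition block_mat ::
    "real^'a^'a \<Rightarrow> real^'b^'a \<Rightarrow> real^'a^'b \<Rightarrow> real^'b^'b \<Rightarrow> real^('a + 'b)^('a + 'b)" where
  "block_mat A B C D =
     (\<chi> i j. case i of
        Inl a \<Rightarrow> (case j of Inl a' \<Rightarrow> A $ a $ a' | Inr b' \<Rightarrow> B $ a $ b')
      | Inr b \<Rightarrow> (case j of Inl a' \<Rightarrow> C $ b $ a' | Inr b' \<Rightarrow> D $ b $ b'))"

definition symmetric_pos_def :: "real^'n^'n \<Rightarrow> bool" where
  "symmetric_pos_def A \<longleftrightarrow> transpose A = A \<and> (\<forall>v. v \<noteq> 0 \<longrightarrow> (A *v v) \<bullet> v > 0)"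

text \<open>A point of \<open>\<real>\<^sup>6\<close>, written \<open>real^(3 + 3)\<close>, is \<open>x = (M, \<gamma>)\<close>.\<close>

definition Mpart :: "real^(3 + 3) \<Rightarrow> real^3" where
  "Mpart x = (\<chi> i. x $ Inl i)"

definition gpart :: "real^(3 + 3) \<Rightarrow> real^3" where
  "gpart x = (\<chi> i. x $ Inr i)"

definition phase_space :: "(real^(3 + 3)) set" where
  "phase_space = {x. gpart x \<noteq> 0}"

definition M_block :: "real^3 \<Rightarrow> real^3 \<Rightarrow> real^3^3" where
  "M_block k M = vector
     [vector [0, - M$3 - k$3, M$2 + k$2],
      vector [M$3 + k$3, 0, - M$1 - k$1],
      vector [- M$2 - k$2, M$1 + k$1, 0]]"

definition \<Gamma>_block :: "real^3 \<Rightarrow> real^3^3" where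
  "\<Gamma>_block \<gamma> = vector
     [vector [0, - \<gamma>$3, \<gamma>$2],
      vector [\<gamma>$3, 0, - \<gamma>$1],
      vector [- \<gamma>$2, \<gamma>$1, 0]]"

definition S_fun :: "real^3^3 \<Rightarrow> real^3 \<Rightarrow> real^3 \<Rightarrow> real^3 \<Rightarrow> real" where
  "S_fun A k M \<gamma> = - (((A *v M - M - k) \<bullet> \<gamma>) / ((A *v \<gamma>) \<bullet> \<gamma>))"

definition H_fun :: "real^3^3 \<Rightarrow> real^3 \<Rightarrow> real^3 \<Rightarrow> real^3 \<Rightarrow> real" where
  "H_fun A k M \<gamma> =
     1/2 * ((A *v M) \<bullet> M - ((A *v M - M - k) \<bullet> \<gamma>)\<^sup>2 / ((A *v \<gamma>) \<bullet> \<gamma>))"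

definition g_fun :: "real^3^3 \<Rightarrow> real^3 \<Rightarrow> real" where
  "g_fun A \<gamma> = sqrt ((A *v \<gamma>) \<bullet> \<gamma>)"

definition P_fun :: "real^3^3 \<Rightarrow> real^3 \<Rightarrow> real^3 \<Rightarrow> real^3 \<Rightarrow> real^(3 + 3)^(3 + 3)" where
  "P_fun A k M \<gamma> =
     g_fun A \<gamma> *\<^sub>R block_mat (M_block k M) (\<Gamma>_block \<gamma>) (\<Gamma>_block \<gamma>) 0
     - (g_fun A \<gamma> * S_fun A k M \<gamma>) *\<^sub>R block_mat (\<Gamma>_block \<gamma>) 0 0 0"

definition veselova_field :: "real^3^3 \<Rightarrow> real^3 \<Rightarrow> real^(3 + 3) \<Rightarrow> real^(3 + 3)" where
  "veselova_field A k x =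
     (let M = Mpart x; \<gamma> = gpart x;
          H_M = grad (\<lambda>m. H_fun A k m \<gamma>) M;
          H_\<gamma> = grad (\<lambda>c. H_fun A k M c) \<gamma>
      in join_vec ((M + k - S_fun A k M \<gamma> *\<^sub>R \<gamma>) \<times> H_M + \<gamma> \<times> H_\<gamma>) (\<gamma> \<times> H_M))"

end

theory Submission
  imports Defs
begin

text \<open>The Jacobi identity for \<open>P\<^sub>k\<close> reduces to a condition on its first derivatives, because the
  Hessians cancel by skew symmetry of \<open>P\<^sub>k\<close> and symmetry of second derivatives. With
  \<open>w = M + k - S \<gamma>\<close> the matrix \<open>P\<^sub>k / g\<close> is the Lie-Poisson matrix of \<open>e(3)\<close> at \<open>(w, \<gamma>)\<close>, so the
  condition splits into the Jacobi identity of \<open>e(3)\<close>, with factor \<open>g\<^sup>2\<close>, and a remainder from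
  the derivatives of \<open>g\<close> and \<open>S\<close>. Since \<open>\<gamma> \<times> c\<close> is orthogonal to \<open>\<gamma>\<close>, the remainder vanishes
  by the cyclic identity for products of triple products.\<close>

section \<open>Gradients and smooth functions\<close>

text \<open>Uniqueness of the Frechet derivative, so that the definite description in
  \<open>grad\<close> can be evaluated from any \<open>GDERIV\<close> fact.\<close>

lemma grad_eq:
  assumes "GDERIV f x :> D"
  shows "grad f x = D"
  unfolding grad_def
proof (rule the_equality)
  fix E assume "GDERIV f x :> E"
  then have "(\<lambda>h. h \<bullet> E) = (\<lambda>h. h \<bullet> D)"
    using assms unfolding gderiv_def by (rule has_derivative_unique)
  then have "h \<bullet> (E - D) = 0" for h
    by (metis inner_diff_right right_minus_eq)
  then show "E = D" by (metis inner_eq_zero_iff right_minus_eq)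
qed (fact assms)

lemma GDERIV_imp_continuous_on:
  assumes "\<And>x. x \<in> U \<Longrightarrow> GDERIV f x :> D x"
  shows "continuous_on U f"
  using assms unfolding gderiv_def
  by (meson has_derivative_at_withinI has_derivative_continuous_on)

text \<open>The gradient of a product, an inverse or a square root still contains undifferentiated
  factors. Lowering the order by one makes the induction hypothesis applicable to them.\<close>

lemma Ck_on_Suc_imp: "Ck_on (Suc n) U f \<Longrightarrow> Ck_on n U f"
proof (induction n arbitrary: f)
  case 0
  then show ?case by (auto intro: GDERIV_imp_continuous_on)
next
  case (Suc n)
  from Suc.prems obtain D where "\<forall>x\<in>U. GDERIV f x :> D x"
    "\<forall>b\<in>Basis. Ck_on (Suc n) U (\<lambda>x. D x \<bullet> b)"
    by (subst (asm) Ck_on.simps(2)) blast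
  with Suc.IH show ?case by (subst Ck_on.simps(2)) blast
qed

lemma Ck_on_const: "Ck_on n U (\<lambda>x. c)"
proof (induction n arbitrary: c)
  case (Suc n)
  then show ?case
    by (auto intro!: exI[of _ "\<lambda>x. 0"] GDERIV_const)
qed auto

lemma Ck_on_inner_const: "Ck_on n U (\<lambda>x. x \<bullet> a)"
proof (cases n)
  case (Suc m)
  have "\<forall>x\<in>U. GDERIV (\<lambda>x. x \<bullet> a) x :> (\<lambda>x. a) x"
    by (auto simp: gderiv_def intro!: derivative_eq_intros)
  with Suc show ?thesis by (auto intro!: exI[of _ "\<lambda>x. a"] Ck_on_const)
qed (auto intro: continuous_intros)

lemma Ck_on_add: "Ck_on n U f \<Longrightarrow> Ck_on n U g \<Longrightarrow> Ck_on n U (\<lambda>x. f x + g x)"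
proof (induction n arbitrary: f g)
  case (Suc n)
  from Suc.prems obtain D E where *: "\<forall>x\<in>U. GDERIV f x :> D x" "\<forall>x\<in>U. GDERIV g x :> E x"
    "\<forall>b\<in>Basis. Ck_on n U (\<lambda>x. D x \<bullet> b)" "\<forall>b\<in>Basis. Ck_on n U (\<lambda>x. E x \<bullet> b)" by auto
  then show ?case
    by (auto simp: inner_add_left intro!: exI[of _ "\<lambda>x. D x + E x"] Suc.IH GDERIV_add)
qed (auto intro: continuous_intros)

lemma Ck_on_mult: "Ck_on n U f \<Longrightarrow> Ck_on n U g \<Longrightarrow> Ck_on n U (\<lambda>x. f x * g x)"
proof (induction n arbitrary: f g)
  case (Suc n)
  from Suc.prems obtain D E where *: "\<forall>x\<in>U. GDERIV f x :> D x" "\<forall>x\<in>U. GDERIV g x :> E x"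
    "\<forall>b\<in>Basis. Ck_on n U (\<lambda>x. D x \<bullet> b)" "\<forall>b\<in>Basis. Ck_on n U (\<lambda>x. E x \<bullet> b)" by auto
  with Suc.prems[THEN Ck_on_Suc_imp] show ?case
    by (auto simp: inner_add_left intro!: exI[of _ "\<lambda>x. f x *\<^sub>R E x + g x *\<^sub>R D x"]
        Suc.IH Ck_on_add GDERIV_mult)
qed (auto intro: continuous_intros)

lemma Ck_on_inverse:
  "Ck_on n U f \<Longrightarrow> (\<And>x. x \<in> U \<Longrightarrow> f x \<noteq> 0) \<Longrightarrow> Ck_on n U (\<lambda>x. inverse (f x))"
proof (induction n arbitrary: f)
  case (Suc n)
  from Suc.prems obtain D where *: "\<forall>x\<in>U. GDERIV f x :> D x"
    "\<forall>b\<in>Basis. Ck_on n U (\<lambda>x. D x \<bullet> b)" by auto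
  have inv: "Ck_on n U (\<lambda>x. inverse (f x))"
    using Suc.IH Suc.prems Ck_on_Suc_imp by blast
  have "Ck_on n U (\<lambda>x. - 1 * (inverse (f x) * inverse (f x)) * (D x \<bullet> b))" if "b \<in> Basis" for b
    using inv * that by (intro Ck_on_mult Ck_on_const) auto
  with * Suc.prems(2) show ?case
    by (auto simp: power2_eq_square
        intro!: exI[of _ "\<lambda>x. - (inverse (f x))\<^sup>2 *\<^sub>R D x"] GDERIV_inverse)
qed (auto intro: continuous_intros)

lemma GDERIV_sqrt:
  assumes "GDERIV f x :> D" "f x > 0"
  shows "GDERIV (\<lambda>x. sqrt (f x)) x :> (inverse (sqrt (f x)) / 2) *\<^sub>R D"
  using GDERIV_DERIV_compose[OF assms(1) DERIV_real_sqrt[OF assms(2)]] .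

lemma Ck_on_sqrt:
  "Ck_on n U f \<Longrightarrow> (\<And>x. x \<in> U \<Longrightarrow> f x > 0) \<Longrightarrow> Ck_on n U (\<lambda>x. sqrt (f x))"
proof (induction n arbitrary: f)
  case (Suc n)
  from Suc.prems obtain D where *: "\<forall>x\<in>U. GDERIV f x :> D x"
    "\<forall>b\<in>Basis. Ck_on n U (\<lambda>x. D x \<bullet> b)" by auto
  have sq: "Ck_on n U (\<lambda>x. sqrt (f x))"
    using Suc.IH Suc.prems Ck_on_Suc_imp by blast
  have "sqrt (f x) \<noteq> 0" if "x \<in> U" for x
    using Suc.prems(2)[OF that] by simp
  then have "Ck_on n U (\<lambda>x. 1/2 * inverse (sqrt (f x)) * (D x \<bullet> b))" if "b \<in> Basis" for b
    using sq * that by (intro Ck_on_mult Ck_on_const Ck_on_inverse) auto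
  with * Suc.prems(2) show ?case
    by (auto simp: algebra_simps
        intro!: exI[of _ "\<lambda>x. (inverse (sqrt (f x)) / 2) *\<^sub>R D x"] GDERIV_sqrt)
qed (auto intro: continuous_intros)

section \<open>Closure properties of smooth functions\<close>

named_theorems smooth_intros

lemma smooth_on_const [smooth_intros]: "smooth_on U (\<lambda>x. c)"
  by (simp add: smooth_on_def Ck_on_const)

lemma smooth_on_inner_const: "smooth_on U (\<lambda>x. x \<bullet> a)"
  by (simp add: smooth_on_def Ck_on_inner_const)

lemma smooth_on_add [smooth_intros]:
  "smooth_on U f \<Longrightarrow> smooth_on U g \<Longrightarrow> smooth_on U (\<lambda>x. f x + g x)"
  by (simp add: smooth_on_def Ck_on_add)

lemma smooth_on_mult [smooth_intros]:
  "smooth_on U f \<Longrightarrow> smooth_on U g \<Longrightarrow> smooth_on U (\<lambda>x. f x * g x)"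
  by (simp add: smooth_on_def Ck_on_mult)

lemma smooth_on_minus [smooth_intros]: "smooth_on U f \<Longrightarrow> smooth_on U (\<lambda>x. - f x)"
  using smooth_on_mult[OF smooth_on_const[of U "-1"]] by simp

lemma smooth_on_diff [smooth_intros]:
  "smooth_on U f \<Longrightarrow> smooth_on U g \<Longrightarrow> smooth_on U (\<lambda>x. f x - g x)"
  using smooth_on_add[OF _ smooth_on_minus] by simp

lemma smooth_on_power [smooth_intros]: "smooth_on U f \<Longrightarrow> smooth_on U (\<lambda>x. f x ^ n)"
  by (induction n) (auto intro: smooth_intros)

lemma smooth_on_divide [smooth_intros]:
  "smooth_on U f \<Longrightarrow> smooth_on U g \<Longrightarrow> (\<And>x. x \<in> U \<Longrightarrow> g x \<noteq> 0) \<Longrightarrow> smooth_on U (\<lambda>x. f x / g x)"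
  unfolding divide_inverse
  by (intro smooth_on_mult) (auto simp: smooth_on_def Ck_on_inverse)

lemma smooth_on_sqrt [smooth_intros]:
  "smooth_on U f \<Longrightarrow> (\<And>x. x \<in> U \<Longrightarrow> f x > 0) \<Longrightarrow> smooth_on U (\<lambda>x. sqrt (f x))"
  by (simp add: smooth_on_def Ck_on_sqrt)

lemma smooth_on_sum [smooth_intros]:
  "(\<And>i. i \<in> I \<Longrightarrow> smooth_on U (f i)) \<Longrightarrow> smooth_on U (\<lambda>x. \<Sum>i\<in>I. f i x)"
  by (induction I rule: infinite_finite_induct) (auto intro!: smooth_intros)

lemma smooth_on_vec_nth [smooth_intros]: "smooth_on U (\<lambda>x::real^'n. x $ i)"
  using smooth_on_inner_const[of U "axis i 1"] by (simp add: inner_axis)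

lemma smooth_on_inner_vec [smooth_intros]:
  fixes f g :: "'a::euclidean_space \<Rightarrow> real^'n"
  assumes "\<And>i. smooth_on U (\<lambda>x. f x $ i)" "\<And>i. smooth_on U (\<lambda>x. g x $ i)"
  shows "smooth_on U (\<lambda>x. f x \<bullet> g x)"
  unfolding inner_vec_def inner_real_def by (intro smooth_intros assms)

lemma smooth_on_matrix_vector_mult [smooth_intros]:
  fixes f :: "'a::euclidean_space \<Rightarrow> real^'n"
  assumes "\<And>j. smooth_on U (\<lambda>x. f x $ j)"
  shows "smooth_on U (\<lambda>x. (A *v f x) $ i)"
  unfolding matrix_vector_mult_def by (auto intro!: smooth_intros assms)

lemma smooth_on_imp_GDERIV:
  assumes "smooth_on U f" "x \<in> U"
  shows "GDERIV f x :> grad f x"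
proof -
  have "Ck_on (Suc 0) U f" using assms by (simp add: smooth_on_def del: Ck_on.simps)
  then show ?thesis using assms(2) grad_eq by fastforce
qed

section \<open>Symmetry of second derivatives\<close>

text \<open>The mean value theorem applied to \<open>t \<mapsto> f (x + h u + t w) - f (x + t w)\<close> turns the
  second difference into a difference of first derivatives, to which differentiability of
  the gradient at \<open>x\<close> applies.\<close>

lemma second_difference_tendsto:
  fixes f :: "'a::real_inner \<Rightarrow> real"
  assumes "open U" "x \<in> U" and D: "\<And>y. y \<in> U \<Longrightarrow> GDERIV f y :> D y"
    and L: "(D has_derivative L) (at x)"
  shows "((\<lambda>h. (f (x + h *\<^sub>R u + h *\<^sub>R w) - f (x + h *\<^sub>R u) - f (x + h *\<^sub>R w) + f x) / h\<^sup>2)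
            \<longlongrightarrow> L u \<bullet> w) (at_right 0)"
proof (rule tendstoI)
  fix e :: real assume "e > 0"
  \<comment> \<open>The two first-order remainders together contribute at most
    \<open>h * (e' * (K - 1))\<close>. The summand 1 keeps \<open>K\<close> positive, and the factor
    2 in \<open>e'\<close> leaves room for a strict bound by \<open>h * e\<close>.\<close>
  define K where "K = 2 * (norm u + norm w) * norm w + 1"
  have K: "K > 0" unfolding K_def by (smt (verit) mult_nonneg_nonneg norm_ge_zero)
  define e' where "e' = e / (2 * K)"
  have e': "e' > 0" using \<open>e > 0\<close> K by (simp add: e'_def)
  obtain r where r: "r > 0" "ball x r \<subseteq> U" using assms(1,2) openE by blast
  obtain d where d: "d > 0"
    "\<And>y. norm (y - x) < d \<Longrightarrow> norm (D y - D x - L (y - x)) \<le> e' * norm (y - x)"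
    using L e' unfolding has_derivative_at_alt by blast
  interpret L: bounded_linear L using L by (rule has_derivative_bounded_linear)
  \<comment> \<open>For \<open>h < \<delta>\<close> every point \<open>x + s u + t w\<close> with
    \<open>s\<close> and \<open>t\<close> between 0 and \<open>h\<close> lies in \<open>U\<close>
    and in the range of the estimate for \<open>D\<close>. The summand 1 excludes division by
    zero.\<close>
  define \<delta> where "\<delta> = min r d / (norm u + norm w + 1)"
  have pos: "norm u + norm w + 1 > 0" by (smt (verit) norm_ge_zero)
  have \<delta>: "\<delta> > 0" unfolding \<delta>_def using r(1) d(1) pos by simp
  have "dist ((f (x + h *\<^sub>R u + h *\<^sub>R w) - f (x + h *\<^sub>R u) - f (x + h *\<^sub>R w) + f x) / h\<^sup>2) (L u \<bullet> w) < e"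
    if h: "0 < h" "h < \<delta>" for h
  proof -
    have small: "norm (s *\<^sub>R u + t *\<^sub>R w) \<le> h * (norm u + norm w) \<and> norm (s *\<^sub>R u + t *\<^sub>R w) < min r d"
      if "0 \<le> s" "s \<le> h" "0 \<le> t" "t \<le> h" for s t
    proof -
      have "norm (s *\<^sub>R u + t *\<^sub>R w) \<le> s * norm u + t * norm w"
        using norm_triangle_ineq[of "s *\<^sub>R u" "t *\<^sub>R w"] that by simp
      also have "\<dots> \<le> h * (norm u + norm w)"
        using that by (simp add: algebra_simps add_mono mult_left_mono mult_right_mono)
      finally have *: "norm (s *\<^sub>R u + t *\<^sub>R w) \<le> h * (norm u + norm w)" .
      also have "\<dots> < \<delta> * (norm u + norm w + 1)"
      proof -
        have "h * (norm u + norm w) \<le> \<delta> * (norm u + norm w)"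
          using h by (intro mult_right_mono) auto
        with \<delta> show ?thesis by (simp add: algebra_simps)
      qed
      also have "\<dots> = min r d" unfolding \<delta>_def using pos by simp
      finally show ?thesis using * by simp
    qed
    \<comment> \<open>The vanishing term \<open>0 *\<^sub>R u\<close> makes both summands instances
      of \<open>der\<close>, with \<open>s = h\<close> and \<open>s = 0\<close>.\<close>
    define \<phi> where "\<phi> t = f (x + (h *\<^sub>R u + t *\<^sub>R w)) - f (x + (0 *\<^sub>R u + t *\<^sub>R w))" for t
    have inU: "x + (s *\<^sub>R u + t *\<^sub>R w) \<in> U" if "0 \<le> s" "s \<le> h" "0 \<le> t" "t \<le> h" for s t
    proof -
      have "x + (s *\<^sub>R u + t *\<^sub>R w) \<in> ball x r" using small[OF that] by (simp add: mem_ball dist_commute[of x]) (simp add: dist_norm)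
      then show ?thesis using r by blast
    qed
    have der: "((\<lambda>t. f (x + (s *\<^sub>R u + t *\<^sub>R w))) has_derivative
        (\<lambda>\<tau>. \<tau> * (D (x + (s *\<^sub>R u + t *\<^sub>R w)) \<bullet> w))) (at t within {0..h})"
      if "0 \<le> s" "s \<le> h" "0 \<le> t" "t \<le> h" for s t
    proof -
      have 1: "((\<lambda>t. x + (s *\<^sub>R u + t *\<^sub>R w)) has_derivative (\<lambda>\<tau>. \<tau> *\<^sub>R w)) (at t within {0..h})"
        by (auto intro!: derivative_eq_intros)
      have 2: "(f has_derivative (\<lambda>v. v \<bullet> D (x + (s *\<^sub>R u + t *\<^sub>R w)))) (at (x + (s *\<^sub>R u + t *\<^sub>R w)))"
        using D[OF inU[OF that]] by (simp add: gderiv_def)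
      from has_derivative_compose[OF 1 2] show ?thesis by (simp add: inner_commute)
    qed
    have "\<exists>\<xi>\<in>{0<..<h}. \<phi> h - \<phi> 0 = (\<lambda>t \<tau>. \<tau> * (D (x + (h *\<^sub>R u + t *\<^sub>R w)) \<bullet> w)
          - \<tau> * (D (x + (0 *\<^sub>R u + t *\<^sub>R w)) \<bullet> w)) \<xi> (h - 0)"
      using h unfolding \<phi>_def by (intro mvt_simple has_derivative_diff der) auto
    then obtain \<xi> where \<xi>: "0 < \<xi>" "\<xi> < h" "\<phi> h - \<phi> 0 =
        h * (D (x + (h *\<^sub>R u + \<xi> *\<^sub>R w)) \<bullet> w) - h * (D (x + (0 *\<^sub>R u + \<xi> *\<^sub>R w)) \<bullet> w)" by auto
    define R where "R s = D (x + (s *\<^sub>R u + \<xi> *\<^sub>R w)) - D x - L (s *\<^sub>R u + \<xi> *\<^sub>R w)" for s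
    have R: "norm (R s) \<le> e' * (h * (norm u + norm w))" if "s = 0 \<or> s = h" for s
    proof -
      have s: "norm (s *\<^sub>R u + \<xi> *\<^sub>R w) \<le> h * (norm u + norm w)" "norm (s *\<^sub>R u + \<xi> *\<^sub>R w) < d"
        using small[of s \<xi>] that h \<xi> by auto
      have "norm (R s) \<le> e' * norm (s *\<^sub>R u + \<xi> *\<^sub>R w)"
        unfolding R_def using d(2)[of "x + (s *\<^sub>R u + \<xi> *\<^sub>R w)"] s(2) by simp
      also have "\<dots> \<le> e' * (h * (norm u + norm w))" using s(1) e' by simp
      finally show ?thesis .
    qed
    \<comment> \<open>The contributions \<open>L (\<xi> *\<^sub>R w)\<close> of the two points
      cancel by linearity, so only \<open>h * (L u \<bullet> w)\<close> and the remainders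
      survive.\<close>
    have "\<phi> h - \<phi> 0 = h * (h * (L u \<bullet> w) + (R h - R 0) \<bullet> w)"
      unfolding \<xi>(3) R_def by (simp add: L.add L.scaleR inner_diff_left inner_add_left algebra_simps)
    then have eq: "(\<phi> h - \<phi> 0) / h\<^sup>2 - L u \<bullet> w = (R h - R 0) \<bullet> w / h"
      using h by (simp add: field_simps power2_eq_square)
    have "\<bar>(R h - R 0) \<bullet> w\<bar> \<le> norm (R h - R 0) * norm w" by (rule Cauchy_Schwarz_ineq2)
    also have "\<dots> \<le> (2 * (e' * (h * (norm u + norm w)))) * norm w"
      using R[of h] R[of 0] norm_triangle_ineq4[of "R h" "R 0"] by (intro mult_right_mono) auto
    also have "\<dots> = h * (e' * (K - 1))" by (simp add: K_def algebra_simps)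
    also have "\<dots> < h * e"
    proof -
      have "e' * (K - 1) < e' * K" using e' by simp
      also have "\<dots> = e / 2" using K by (simp add: e'_def)
      finally show ?thesis using h \<open>e > 0\<close> by simp
    qed
    finally have "\<bar>(R h - R 0) \<bullet> w / h\<bar> < e" using h by (simp add: field_simps abs_mult)
    then show ?thesis unfolding dist_real_def eq[symmetric]
      by (simp add: \<phi>_def algebra_simps)
  qed
  then show "\<forall>\<^sub>F h in at_right 0. dist ((f (x + h *\<^sub>R u + h *\<^sub>R w) - f (x + h *\<^sub>R u)
      - f (x + h *\<^sub>R w) + f x) / h\<^sup>2) (L u \<bullet> w) < e"
    using \<delta> unfolding eventually_at_right_field by blast
qed

text \<open>The second difference does not change when \<open>u\<close> and \<open>w\<close> are
  exchanged, and its limit is unique.\<close>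

lemma second_derivative_symmetric:
  fixes f :: "'a::real_inner \<Rightarrow> real"
  assumes "open U" "x \<in> U" "\<And>y. y \<in> U \<Longrightarrow> GDERIV f y :> D y" "(D has_derivative L) (at x)"
  shows "L u \<bullet> w = L w \<bullet> u"
proof (rule tendsto_unique)
  show "at_right (0::real) \<noteq> bot" by simp
  show "((\<lambda>h. (f (x + h *\<^sub>R u + h *\<^sub>R w) - f (x + h *\<^sub>R u) - f (x + h *\<^sub>R w) + f x) / h\<^sup>2)
            \<longlongrightarrow> L u \<bullet> w) (at_right 0)"
    by (rule second_difference_tendsto[OF assms])
  show "((\<lambda>h. (f (x + h *\<^sub>R u + h *\<^sub>R w) - f (x + h *\<^sub>R u) - f (x + h *\<^sub>R w) + f x) / h\<^sup>2)
            \<longlongrightarrow> L w \<bullet> u) (at_right 0)"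
    using second_difference_tendsto[OF assms, of w u] by (simp add: algebra_simps)
qed

text \<open>Class C^2 gives a derivative of each component of the gradient; summing over the basis
  yields the Hessian \<open>L\<close>. Openness of \<open>U\<close> allows the passage from the
  local gradient \<open>D\<close> to \<open>grad f\<close>.\<close>

lemma smooth_on_grad_has_derivative:
  fixes f :: "'a::euclidean_space \<Rightarrow> real"
  assumes "open U" "smooth_on U f" "x \<in> U"
  obtains L where "(grad f has_derivative L) (at x)" "\<And>u w. L u \<bullet> w = L w \<bullet> u"
proof -
  have "Ck_on (Suc (Suc 0)) U f" using assms(2) unfolding smooth_on_def by blast
  then obtain D where D: "\<forall>y\<in>U. GDERIV f y :> D y"
    "\<forall>b\<in>Basis. Ck_on (Suc 0) U (\<lambda>y. D y \<bullet> b)"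
    by (subst (asm) Ck_on.simps) blast
  have "\<forall>b\<in>Basis. \<exists>l. ((\<lambda>y. D y \<bullet> b) has_derivative l) (at x)"
    using D(2) assms(3) by (subst (asm) Ck_on.simps) (metis gderiv_def)
  then obtain l where "\<forall>b\<in>Basis. ((\<lambda>y. D y \<bullet> b) has_derivative l b) (at x)" by metis
  then have "((\<lambda>y. \<Sum>b\<in>Basis. (D y \<bullet> b) *\<^sub>R b) has_derivative (\<lambda>h. \<Sum>b\<in>Basis. l b h *\<^sub>R b)) (at x)"
    by (intro has_derivative_sum has_derivative_scaleR_left) auto
  then have L: "(D has_derivative (\<lambda>h. \<Sum>b\<in>Basis. l b h *\<^sub>R b)) (at x)"
    by (simp add: euclidean_representation)
  have "(grad f has_derivative (\<lambda>h. \<Sum>b\<in>Basis. l b h *\<^sub>R b)) (at x)"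
    by (rule has_derivative_transform_within_open[OF L assms(1,3)]) (use D(1) grad_eq in metis)
  then show thesis using second_derivative_symmetric[OF assms(1,3) _ L] D(1) that by blast
qed

section \<open>Poisson structures and first integrals\<close>

text \<open>Product rule for a bracket of two functions. The double sum is the derivative of the
  matrix alone, with \<open>a\<close> and \<open>b\<close> frozen at \<open>x\<close>.\<close>

lemma has_derivative_inner_matrix_vector:
  fixes P :: "'a::real_normed_vector \<Rightarrow> real^'n^'m"
  assumes a: "(a has_derivative a') (at x)" and b: "(b has_derivative b') (at x)"
    and P: "\<And>i j. ((\<lambda>y. P y $ i $ j) has_derivative p i j) (at x)"
  shows "((\<lambda>y. a y \<bullet> (P y *v b y)) has_derivative
    (\<lambda>h. a' h \<bullet> (P x *v b x) + a x \<bullet> (P x *v b' h)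
       + (\<Sum>i\<in>UNIV. \<Sum>j\<in>UNIV. a x $ i * p i j h * b x $ j))) (at x)"
proof -
  have ai: "((\<lambda>y. a y $ i) has_derivative (\<lambda>h. a' h $ i)) (at x)"
    and bj: "((\<lambda>y. b y $ j) has_derivative (\<lambda>h. b' h $ j)) (at x)" for i j
    by (rule bounded_linear.has_derivative[OF bounded_linear_vec_nth a]
        bounded_linear.has_derivative[OF bounded_linear_vec_nth b])+
  have "((\<lambda>y. \<Sum>i\<in>UNIV. \<Sum>j\<in>UNIV. a y $ i * (P y $ i $ j * b y $ j)) has_derivative
    (\<lambda>h. \<Sum>i\<in>UNIV. \<Sum>j\<in>UNIV. a x $ i * (P x $ i $ j * b' h $ j + p i j h * b x $ j)
       + a' h $ i * (P x $ i $ j * b x $ j))) (at x)"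
    by (intro has_derivative_sum has_derivative_mult ai bj P)
  then show ?thesis
    by (simp add: inner_vec_def matrix_vector_mult_def sum_distrib_left sum.distrib algebra_simps)
qed

text \<open>Replaces three arbitrary functions by three constant covectors: the Hessian terms of the
  cyclic sum cancel in pairs, and what remains depends only on the gradients at \<open>x\<close> and
  on the first derivatives \<open>T\<close> of the matrix.\<close>

lemma poisson_structureI:
  fixes P :: "real^'n \<Rightarrow> real^'n^'n"
  assumes "open U"
    and smooth: "\<And>i j. smooth_on U (\<lambda>x. P x $ i $ j)"
    and skew: "\<And>x a b. x \<in> U \<Longrightarrow> a \<bullet> (P x *v b) = - (b \<bullet> (P x *v a))"
    and T: "\<And>x a b. x \<in> U \<Longrightarrow> ((\<lambda>y. a \<bullet> (P y *v b)) has_derivative T x a b) (at x)"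
    and jac: "\<And>x a b c. x \<in> U \<Longrightarrow>
      T x a b (P x *v c) + T x b c (P x *v a) + T x c a (P x *v b) = 0"
  shows "poisson_structure U P"
  unfolding poisson_structure_def
proof (intro conjI allI ballI impI smooth)
  fix x assume "x \<in> U"
  have "transpose (P x) $ i $ j = (- P x) $ i $ j" for i j
    using skew[OF \<open>x \<in> U\<close>, of "axis j 1" "axis i 1"]
    by (simp add: transpose_def inner_axis' matrix_vector_mul_component inner_axis)
  then show "transpose (P x) = - P x" by (simp add: vec_eq_iff)
next
  fix F G H :: "real^'n \<Rightarrow> real" and x
  assume sm: "smooth_on U F" "smooth_on U G" "smooth_on U H" and x: "x \<in> U"
  have P': "((\<lambda>y. P y $ i $ j) has_derivative (\<lambda>h. h \<bullet> grad (\<lambda>y. P y $ i $ j) x)) (at x)" for i j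
    using smooth_on_imp_GDERIV[OF smooth x] by (simp add: gderiv_def)
  \<comment> \<open>Derivatives are unique, so \<open>T\<close> must be the double sum of the
    product rule.\<close>
  have T_eq: "T x a b = (\<lambda>h. \<Sum>i\<in>UNIV. \<Sum>j\<in>UNIV. a $ i * (h \<bullet> grad (\<lambda>y. P y $ i $ j) x) * b $ j)" for a b
    using has_derivative_inner_matrix_vector[OF has_derivative_const has_derivative_const P', of a b]
    by (intro has_derivative_unique[OF T[OF x]]) simp
  \<comment> \<open>The Hessian of \<open>F\<close> is moved by its symmetry, that of
    \<open>G\<close> by skewness of \<open>P x\<close>. In this form each Hessian occurs twice in
    the cyclic sum, in identical terms of opposite sign.\<close>
  have bracket: "bracket P (bracket P F G) H x =
      (P x *v grad H x) \<bullet> D (P x *v grad G x) - (P x *v grad F x) \<bullet> E (P x *v grad H x)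
      + T x (grad F x) (grad G x) (P x *v grad H x)"
    if D: "(grad F has_derivative D) (at x)" "\<And>u w. D u \<bullet> w = D w \<bullet> u"
      and E: "(grad G has_derivative E) (at x)" for F G H :: "real^'n \<Rightarrow> real" and D E
  proof -
    let ?f = "\<lambda>h. D h \<bullet> (P x *v grad G x) + grad F x \<bullet> (P x *v E h) + T x (grad F x) (grad G x) h"
    have der: "(bracket P F G has_derivative ?f) (at x)"
      using has_derivative_inner_matrix_vector[OF D(1) E P'] by (simp add: bracket_def[abs_def] T_eq)
    then interpret f: bounded_linear ?f by (rule has_derivative_bounded_linear)
    \<comment> \<open>A linear functional is the inner product with the vector of its values on the
      basis; this vector is the gradient of the inner bracket.\<close>
    have f_eq: "?f h = h \<bullet> (\<Sum>b\<in>Basis. ?f b *\<^sub>R b)" for h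
    proof -
      have "?f h = ?f (\<Sum>b\<in>Basis. (h \<bullet> b) *\<^sub>R b)" by (simp only: euclidean_representation)
      also have "\<dots> = (\<Sum>b\<in>Basis. (h \<bullet> b) * ?f b)" by (simp only: f.sum f.scaleR real_scaleR_def)
      finally show ?thesis by (simp add: inner_sum_right mult.commute)
    qed
    then have "?f = (\<lambda>h. h \<bullet> (\<Sum>b\<in>Basis. ?f b *\<^sub>R b))" by (rule ext)
    then have "GDERIV (bracket P F G) x :> (\<Sum>b\<in>Basis. ?f b *\<^sub>R b)"
      unfolding gderiv_def by (rule has_derivative_eq_rhs[OF der])
    from grad_eq[OF this] have "bracket P (bracket P F G) H x = ?f (P x *v grad H x)"
      unfolding bracket_def[of P "bracket P F G"] by (subst f_eq) (simp only: inner_commute)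
    then show ?thesis
      using D(2)[of "P x *v grad H x" "P x *v grad G x"]
        skew[OF x, of "grad F x" "E (P x *v grad H x)"]
      by (simp add: inner_commute)
  qed
  obtain A where A: "(grad F has_derivative A) (at x)" "\<And>u w. A u \<bullet> w = A w \<bullet> u"
    using smooth_on_grad_has_derivative[OF assms(1) sm(1) x] by blast
  obtain B where B: "(grad G has_derivative B) (at x)" "\<And>u w. B u \<bullet> w = B w \<bullet> u"
    using smooth_on_grad_has_derivative[OF assms(1) sm(2) x] by blast
  obtain C where C: "(grad H has_derivative C) (at x)" "\<And>u w. C u \<bullet> w = C w \<bullet> u"
    using smooth_on_grad_has_derivative[OF assms(1) sm(3) x] by blast
  show "bracket P (bracket P F G) H x + bracket P (bracket P G H) F x + bracket P (bracket P H F) G x = 0"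
    unfolding bracket[OF A B(1)] bracket[OF B C(1)] bracket[OF C A(1)]
    using jac[OF x, of "grad F x" "grad G x" "grad H x"]
    by simp
qed

text \<open>By the chain rule \<open>F (X t)\<close> has derivative zero within the interval, which
  is convex, so it is constant there.\<close>

lemma first_integralI:
  fixes F :: "'a::euclidean_space \<Rightarrow> real"
  assumes "smooth_on U F" "\<And>x. x \<in> U \<Longrightarrow> grad F x \<bullet> v x = 0"
  shows "first_integral U v F"
  unfolding first_integral_def
proof (intro conjI allI impI ballI assms(1))
  fix I :: "real set" and X s t
  assume I: "is_interval I" and X: "solution_on U v I X" and st: "s \<in> I" "t \<in> I"
  have der: "((\<lambda>t. F (X t)) has_derivative (\<lambda>h. 0)) (at \<tau> within I)" if "\<tau> \<in> I" for \<tau>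
  proof -
    have "X \<tau> \<in> U" "(X has_derivative (\<lambda>h. h *\<^sub>R v (X \<tau>))) (at \<tau> within I)"
      using X that by (auto simp: solution_on_def has_vector_derivative_def)
    moreover from this(1) have "(F has_derivative (\<lambda>h. h \<bullet> grad F (X \<tau>))) (at (X \<tau>))"
      using smooth_on_imp_GDERIV[OF assms(1)] by (simp add: gderiv_def)
    ultimately show ?thesis
      using has_derivative_compose assms(2) by (fastforce simp: inner_commute)
  qed
  then show "F (X s) = F (X t)"
    using has_derivative_zero_unique[of I "\<lambda>t. F (X t)" s t] I st
    by (metis is_interval_convex)
qed

section \<open>Points of the phase space as pairs of vectors\<close>

lemma Mpart_join_vec [simp]: "Mpart (join_vec u w) = u"
  and gpart_join_vec [simp]: "gpart (join_vec u w) = w"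
  by (simp_all add: Mpart_def gpart_def join_vec_def vec_eq_iff)

lemma join_vec_parts [simp]: "join_vec (Mpart x) (gpart x) = x"
  by (simp add: Mpart_def gpart_def join_vec_def vec_eq_iff split: sum.split)

lemma parts_eqI: "Mpart x = Mpart y \<Longrightarrow> gpart x = gpart y \<Longrightarrow> x = y"
  by (metis join_vec_parts)

lemma sum_UNIV_Plus:
  "(\<Sum>i\<in>(UNIV :: ('a::finite + 'b::finite) set). f i) = (\<Sum>i\<in>UNIV. f (Inl i)) + (\<Sum>i\<in>UNIV. f (Inr i))"
  by (simp flip: UNIV_Plus_UNIV add: sum.Plus)

lemma inner_eq_parts: "x \<bullet> y = Mpart x \<bullet> Mpart y + gpart x \<bullet> gpart y"
  by (simp add: inner_vec_def sum_UNIV_Plus Mpart_def gpart_def)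

lemma parts_linear [simp]:
  "Mpart 0 = 0" "Mpart (x + y) = Mpart x + Mpart y" "Mpart (x - y) = Mpart x - Mpart y"
  "Mpart (c *\<^sub>R x) = c *\<^sub>R Mpart x"
  "gpart 0 = 0" "gpart (x + y) = gpart x + gpart y" "gpart (x - y) = gpart x - gpart y"
  "gpart (c *\<^sub>R x) = c *\<^sub>R gpart x"
  by (simp_all add: Mpart_def gpart_def vec_eq_iff)

lemma bounded_linear_Mpart: "bounded_linear Mpart"
  and bounded_linear_gpart: "bounded_linear gpart"
  by (auto simp: linear_conv_bounded_linear[symmetric] intro!: linearI)

lemmas has_derivative_Mpart [derivative_intros] = bounded_linear.has_derivative[OF bounded_linear_Mpart]
lemmas has_derivative_gpart [derivative_intros] = bounded_linear.has_derivative[OF bounded_linear_gpart]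

lemma smooth_on_Mpart [smooth_intros]: "smooth_on U (\<lambda>x. Mpart x $ i)"
  and smooth_on_gpart [smooth_intros]: "smooth_on U (\<lambda>x. gpart x $ i)"
  unfolding Mpart_def gpart_def by (simp_all add: smooth_on_vec_nth)

lemma open_phase_space: "open phase_space"
  unfolding phase_space_def
  by (intro open_Collect_neq linear_continuous_on bounded_linear_gpart continuous_on_const)

text \<open>Fixing one block is an affine embedding, and the adjoint of its linear part is the
  projection to the other block. This links the partial gradients in the equations of motion to the
  full gradient in the Poisson form.\<close>

lemma GDERIV_partial:
  assumes "GDERIV f (join_vec m c) :> D"
  shows "GDERIV (\<lambda>m. f (join_vec m c)) m :> Mpart D"
    and "GDERIV (\<lambda>c. f (join_vec m c)) c :> gpart D"
proof -
  have bl: "bounded_linear (\<lambda>u::real^3. join_vec u (0::real^3))"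
    "bounded_linear (\<lambda>w::real^3. join_vec (0::real^3) w)"
    by (auto simp: linear_conv_bounded_linear[symmetric] intro!: linearI parts_eqI)
  have split: "join_vec u w = join_vec u 0 + join_vec 0 w" for u w :: "real^3"
    by (auto intro: parts_eqI)
  have "((\<lambda>u. join_vec u c) has_derivative (\<lambda>h. join_vec h 0)) (at m)"
    by (subst split, rule has_derivative_add_const[OF bounded_linear_imp_has_derivative[OF bl(1)]])
  from has_derivative_compose[OF this assms[unfolded gderiv_def]]
  show "GDERIV (\<lambda>m. f (join_vec m c)) m :> Mpart D"
    by (simp add: gderiv_def inner_eq_parts)
  have "((\<lambda>w. join_vec m w) has_derivative (\<lambda>h. join_vec 0 h)) (at c)"
    using has_derivative_add[OF has_derivative_const bounded_linear_imp_has_derivative[OF bl(2)]]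
    by (subst split) simp
  from has_derivative_compose[OF this assms[unfolded gderiv_def]]
  show "GDERIV (\<lambda>c. f (join_vec m c)) c :> gpart D"
    by (simp add: gderiv_def inner_eq_parts)
qed

section \<open>The structure matrix in terms of cross products\<close>

lemma block_mat_mult_vec:
  fixes A B C D :: "real^3^3"
  shows "block_mat A B C D *v x = join_vec (A *v Mpart x + B *v gpart x) (C *v Mpart x + D *v gpart x)"
  by (auto simp: vec_eq_iff matrix_vector_mult_def sum_UNIV_Plus block_mat_def join_vec_def
      Mpart_def gpart_def split: sum.split)

lemma \<Gamma>_block_mult_vec: "\<Gamma>_block \<gamma> *v u = \<gamma> \<times> u"
  by (simp add: vec_eq_iff forall_3 \<Gamma>_block_def matrix_vector_mult_def sum_3 cross_components)

lemma M_block_mult_vec: "M_block k M *v u = (M + k) \<times> u"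
  by (simp add: vec_eq_iff forall_3 M_block_def matrix_vector_mult_def sum_3 cross_components
      algebra_simps)

lemma P_fun_mult_vec:
  "P_fun A k M \<gamma> *v b = g_fun A \<gamma> *\<^sub>R
     join_vec ((M + k - S_fun A k M \<gamma> *\<^sub>R \<gamma>) \<times> Mpart b + \<gamma> \<times> gpart b) (\<gamma> \<times> Mpart b)"
  by (rule parts_eqI) (simp_all add: P_fun_def matrix_vector_mult_diff_rdistrib
      scaleR_matrix_vector_assoc[symmetric] block_mat_mult_vec \<Gamma>_block_mult_vec
      M_block_mult_vec Cross3.left_diff_distrib cross_mult_left algebra_simps)

text \<open>Both covectors are collected in cross products, so that skewness is visible and only
  \<open>g\<close>, \<open>S\<close>, \<open>M\<close> and \<gamma> have to be
  differentiated.\<close>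

lemma inner_P_fun:
  "a \<bullet> (P_fun A k M \<gamma> *v b) = g_fun A \<gamma> *
     ((M + k - S_fun A k M \<gamma> *\<^sub>R \<gamma>) \<bullet> (Mpart b \<times> Mpart a)
      + \<gamma> \<bullet> (gpart b \<times> Mpart a + Mpart b \<times> gpart a))"
  unfolding P_fun_mult_vec inner_eq_parts
  by (simp add: inner_add_right cross_triple inner_commute algebra_simps)
    (simp add: cross3_simps)

section \<open>The Jacobi identity for \<open>P\<close>\<close>

text \<open>Cramer's rule paired with \<open>v\<close>: the determinant of \<open>c\<close>,
  \<open>b\<close>, \<open>a\<close> times \<open>n\<close> is a combination of the pairwise cross
  products, with the inner products with \<open>n\<close> as coefficients.\<close>

lemma triple_product_cyclic_sum:
  fixes a b c n v :: "real^3"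
  shows "(c \<bullet> n) * (v \<bullet> (b \<times> a)) + (a \<bullet> n) * (v \<bullet> (c \<times> b)) + (b \<bullet> n) * (v \<bullet> (a \<times> c))
    = (n \<bullet> v) * (c \<bullet> (b \<times> a))"
  by (simp add: cross3_simps)

text \<open>The Jacobi identity of the semidirect sum of so(3) and the translations, evaluated at
  the point \<open>(w, \<gamma>)\<close>. Every term is an inner product of two cross products, and
  the Binet-Cauchy expansion makes them cancel.\<close>

lemma e3_jacobi:
  fixes w \<gamma> a1 a2 b1 b2 c1 c2 :: "real^3"
  shows "(w \<times> c1 + \<gamma> \<times> c2) \<bullet> (b1 \<times> a1) + (\<gamma> \<times> c1) \<bullet> (b2 \<times> a1 + b1 \<times> a2)
    + ((w \<times> a1 + \<gamma> \<times> a2) \<bullet> (c1 \<times> b1) + (\<gamma> \<times> a1) \<bullet> (c2 \<times> b1 + c1 \<times> b2))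
    + ((w \<times> b1 + \<gamma> \<times> b2) \<bullet> (a1 \<times> c1) + (\<gamma> \<times> b1) \<bullet> (a2 \<times> c1 + a1 \<times> c2)) = 0"
  by (simp add: dot_cross inner_add_left inner_add_right inner_commute)

text \<open>\<open>K\<close> is the contribution of the derivatives of \<open>g\<close> and
  \<open>S\<close>, where \<open>y\<close>, \<open>r\<close>, \<open>s\<close> stand for
  \<open>A *v \<gamma>\<close>, \<open>A *v M\<close> and \<open>2 * S\<close>. Each cyclic sum is a
  determinant times some \<open>n \<bullet> v\<close>: either \<open>n\<close> is orthogonal to
  \<open>v = \<gamma>\<close>, or the two mixed products of \<open>y\<close>, \<gamma> and
  \<open>w\<close> are opposite.\<close>

lemma conformal_jacobi:
  fixes w \<gamma> y r a1 a2 b1 b2 c1 c2 :: "real^3" and s :: real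
  defines "K \<equiv> \<lambda>a1 a2 b1 b2 c1 c2.
    (y \<bullet> (\<gamma> \<times> c1)) * (w \<bullet> (b1 \<times> a1) + \<gamma> \<bullet> (b2 \<times> a1 + b1 \<times> a2))
    + ((w \<times> c1 + \<gamma> \<times> c2) \<bullet> y - (w \<times> c1 + \<gamma> \<times> c2) \<bullet> \<gamma> + (r - w) \<bullet> (\<gamma> \<times> c1)
       + s * (y \<bullet> (\<gamma> \<times> c1))) * (\<gamma> \<bullet> (b1 \<times> a1))"
  shows "K a1 a2 b1 b2 c1 c2 + K b1 b2 c1 c2 a1 a2 + K c1 c2 a1 a2 b1 b2 = 0"
proof -
  have rot: "u \<bullet> (v \<times> c) = c \<bullet> (u \<times> v)" "(v \<times> c) \<bullet> u = c \<bullet> (u \<times> v)" for u v c :: "real^3"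
    by (simp_all add: cross3_simps)
  have K: "K a1 a2 b1 b2 c1 c2 =
      (c1 \<bullet> (y \<times> \<gamma>)) * (w \<bullet> (b1 \<times> a1)) + (c1 \<bullet> (y \<times> w)) * (\<gamma> \<bullet> (b1 \<times> a1))
      + (c1 \<bullet> (r \<times> \<gamma>)) * (\<gamma> \<bullet> (b1 \<times> a1)) + s * ((c1 \<bullet> (y \<times> \<gamma>)) * (\<gamma> \<bullet> (b1 \<times> a1)))
      + ((c1 \<bullet> (y \<times> \<gamma>)) * (\<gamma> \<bullet> (b2 \<times> a1)) + (c1 \<bullet> (y \<times> \<gamma>)) * (\<gamma> \<bullet> (b1 \<times> a2))
         + (c2 \<bullet> (y \<times> \<gamma>)) * (\<gamma> \<bullet> (b1 \<times> a1)))" for a1 a2 b1 b2 c1 c2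
  proof -
    \<comment> \<open>Hence the second summand in the bracket of \<open>K\<close> cancels the part
      of the third that contains \<open>w\<close>.\<close>
    have "(w \<times> c1 + \<gamma> \<times> c2) \<bullet> \<gamma> = - (w \<bullet> (\<gamma> \<times> c1))"
      by (simp add: cross3_simps)
    moreover have "(w \<times> c1 + \<gamma> \<times> c2) \<bullet> y = c1 \<bullet> (y \<times> w) + c2 \<bullet> (y \<times> \<gamma>)"
      "y \<bullet> (\<gamma> \<times> c1) = c1 \<bullet> (y \<times> \<gamma>)" "r \<bullet> (\<gamma> \<times> c1) = c1 \<bullet> (r \<times> \<gamma>)"
      by (simp_all only: rot inner_add_left)
    ultimately show ?thesis
      unfolding K_def by (simp add: inner_diff_left inner_add_right algebra_simps)
  qed
  \<comment> \<open>Here \<open>n = z \<times> \<gamma>\<close> and \<open>v = \<gamma>\<close> are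
    orthogonal.\<close>
  have tri: "(c \<bullet> (z \<times> \<gamma>)) * (\<gamma> \<bullet> (b \<times> a)) + (a \<bullet> (z \<times> \<gamma>)) * (\<gamma> \<bullet> (c \<times> b))
      + (b \<bullet> (z \<times> \<gamma>)) * (\<gamma> \<bullet> (a \<times> c)) = 0" for a b c z :: "real^3"
    by (simp add: triple_product_cyclic_sum dot_cross_self)
  have "(y \<times> \<gamma>) \<bullet> w + (y \<times> w) \<bullet> \<gamma> = 0"
    by (simp add: cross3_simps)
  then have w: "((y \<times> \<gamma>) \<bullet> w) * d + ((y \<times> w) \<bullet> \<gamma>) * d = 0" for d
    by (metis distrib_right mult_zero_left)
  \<comment> \<open>The multiple by \<open>s\<close> is stated separately because the concluding
    linear arithmetic treats such products as atoms.\<close>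
  have "s * (c1 \<bullet> y \<times> \<gamma> * (\<gamma> \<bullet> b1 \<times> a1)) + s * (a1 \<bullet> y \<times> \<gamma> * (\<gamma> \<bullet> c1 \<times> b1))
      + s * (b1 \<bullet> y \<times> \<gamma> * (\<gamma> \<bullet> a1 \<times> c1)) = 0"
    unfolding distrib_left[symmetric] tri by simp
  then show ?thesis
    unfolding K
    using triple_product_cyclic_sum[of c1 "y \<times> \<gamma>" w b1 a1]
      triple_product_cyclic_sum[of c1 "y \<times> w" \<gamma> b1 a1] w[of "c1 \<bullet> (b1 \<times> a1)"]
      tri[of c1 r b1 a1] tri[of c1 y b1 a2] tri[of c1 y b2 a1] tri[of c2 y b1 a1]
    by linarith
qed

section \<open>Smoothness and derivatives of the coefficients and of the Hamiltonian\<close>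

context
  fixes A :: "real^3^3" and k :: "real^3"
  assumes A: "symmetric_pos_def A"
begin

lemma matrix_symmetric: "(A *v u) \<bullet> v = (A *v v) \<bullet> u"
  using A by (metis dot_lmul_matrix inner_commute symmetric_pos_def_def transpose_matrix_vector)

lemma quadratic_form_pos: "x \<in> phase_space \<Longrightarrow> (A *v gpart x) \<bullet> gpart x > 0"
  using A by (simp add: symmetric_pos_def_def phase_space_def)

lemma g_fun_pos: "x \<in> phase_space \<Longrightarrow> g_fun A (gpart x) > 0"
  by (simp add: g_fun_def quadratic_form_pos)

lemma smooth_on_quadratic_form: "smooth_on U (\<lambda>x. (A *v gpart x) \<bullet> gpart x)"
  by (intro smooth_on_inner_vec smooth_on_matrix_vector_mult smooth_on_gpart)

lemma smooth_on_sigma: "smooth_on U (\<lambda>x. (A *v Mpart x - Mpart x - k) \<bullet> gpart x)"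
  by (intro smooth_on_inner_vec)
    (simp_all add: smooth_on_gpart smooth_on_diff smooth_on_const smooth_on_matrix_vector_mult smooth_on_Mpart)

lemma smooth_on_g_fun: "smooth_on phase_space (\<lambda>x. g_fun A (gpart x))"
  unfolding g_fun_def
  by (intro smooth_on_sqrt smooth_on_quadratic_form quadratic_form_pos)

lemma smooth_on_S_fun: "smooth_on phase_space (\<lambda>x. S_fun A k (Mpart x) (gpart x))"
  unfolding S_fun_def
  by (intro smooth_on_minus smooth_on_divide smooth_on_quadratic_form smooth_on_sigma)
    (use quadratic_form_pos in force)

lemma smooth_on_H_fun: "smooth_on phase_space (\<lambda>x. H_fun A k (Mpart x) (gpart x))"
  unfolding H_fun_def
  by (intro smooth_on_mult smooth_on_const smooth_on_diff smooth_on_divide smooth_on_power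
      smooth_on_quadratic_form smooth_on_sigma smooth_on_inner_vec smooth_on_Mpart
      smooth_on_matrix_vector_mult) (use quadratic_form_pos in force)

lemma has_derivative_quadratic_form:
  "((\<lambda>y. (A *v gpart y) \<bullet> gpart y) has_derivative (\<lambda>u. 2 * ((A *v gpart x) \<bullet> gpart u))) (at x)"
  by (rule has_derivative_eq_rhs, rule has_derivative_inner,
      rule bounded_linear.has_derivative[OF matrix_vector_mul_bounded_linear],
      (rule has_derivative_gpart has_derivative_ident)+)
    (use matrix_symmetric[of "gpart x"] in \<open>simp add: inner_commute fun_eq_iff\<close>)

lemma has_derivative_sigma:
  "((\<lambda>y. (A *v Mpart y - Mpart y - k) \<bullet> gpart y) has_derivative
     (\<lambda>u. (A *v Mpart u - Mpart u) \<bullet> gpart x + (A *v Mpart x - Mpart x - k) \<bullet> gpart u)) (at x)"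
  by (rule has_derivative_eq_rhs, rule has_derivative_inner,
      (rule has_derivative_diff bounded_linear.has_derivative[OF matrix_vector_mul_bounded_linear]
        has_derivative_Mpart has_derivative_gpart has_derivative_ident has_derivative_const)+)
    (simp add: fun_eq_iff)

text \<open>Quotient rule, in which the numerator of \<open>S\<close> is expressed through
  \<open>S\<close> again; this leaves a single power of the quadratic form in the
  denominator.\<close>

lemma has_derivative_S_fun:
  assumes "x \<in> phase_space"
  shows "((\<lambda>y. S_fun A k (Mpart y) (gpart y)) has_derivative
    (\<lambda>u. - ((A *v Mpart u - Mpart u) \<bullet> gpart x + (A *v Mpart x - Mpart x - k) \<bullet> gpart u
          + 2 * S_fun A k (Mpart x) (gpart x) * ((A *v gpart x) \<bullet> gpart u))
        / ((A *v gpart x) \<bullet> gpart x))) (at x)"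
  unfolding S_fun_def
  by (rule has_derivative_eq_rhs, rule has_derivative_minus,
      rule has_derivative_divide'[OF has_derivative_sigma has_derivative_quadratic_form])
    (use quadratic_form_pos[OF assms] in \<open>auto simp: fun_eq_iff field_simps\<close>)

lemma has_derivative_g_fun:
  assumes "x \<in> phase_space"
  shows "((\<lambda>y. g_fun A (gpart y)) has_derivative
    (\<lambda>u. ((A *v gpart x) \<bullet> gpart u) / g_fun A (gpart x))) (at x)"
  unfolding g_fun_def
  by (rule has_derivative_eq_rhs, rule has_derivative_real_sqrt[OF _ has_derivative_quadratic_form])
    (use quadratic_form_pos[OF assms] in \<open>auto simp: fun_eq_iff field_simps\<close>)

text \<open>Substituting \<open>?\<sigma> = - S * ?Q\<close> clears all denominators. With the
  angular velocity \<open>\<omega> = A *v (M + S *\<^sub>R \<gamma>)\<close>, the first block is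
  \<open>\<omega> - S *\<^sub>R \<gamma>\<close>.\<close>

lemma GDERIV_H_fun:
  assumes "x \<in> phase_space"
  defines "S \<equiv> S_fun A k (Mpart x) (gpart x)"
  shows "GDERIV (\<lambda>y. H_fun A k (Mpart y) (gpart y)) x :>
    join_vec (A *v Mpart x + S *\<^sub>R (A *v gpart x - gpart x))
      (S *\<^sub>R (A *v Mpart x - Mpart x - k) + S\<^sup>2 *\<^sub>R (A *v gpart x))"
proof -
  let ?Q = "(A *v gpart x) \<bullet> gpart x" and ?\<sigma> = "(A *v Mpart x - Mpart x - k) \<bullet> gpart x"
  have M: "((\<lambda>y. (A *v Mpart y) \<bullet> Mpart y) has_derivative (\<lambda>u. 2 * ((A *v Mpart x) \<bullet> Mpart u))) (at x)"
    by (rule has_derivative_eq_rhs, rule has_derivative_inner,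
        rule bounded_linear.has_derivative[OF matrix_vector_mul_bounded_linear],
        (rule has_derivative_Mpart has_derivative_ident)+)
      (use matrix_symmetric[of "Mpart x"] in \<open>simp add: inner_commute fun_eq_iff\<close>)
  let ?d\<sigma> = "\<lambda>u. (A *v Mpart u - Mpart u) \<bullet> gpart x + (A *v Mpart x - Mpart x - k) \<bullet> gpart u"
  have Q: "?Q > 0" using quadratic_form_pos assms(1) .
  then have \<sigma>: "?\<sigma> = - S * ?Q" by (simp add: S_def S_fun_def)
  have "((\<lambda>y. H_fun A k (Mpart y) (gpart y)) has_derivative
     (\<lambda>u. 1/2 * (2 * ((A *v Mpart x) \<bullet> Mpart u) -
       ((2 * ?\<sigma> * ?d\<sigma> u) * ?Q - ?\<sigma>\<^sup>2 * (2 * ((A *v gpart x) \<bullet> gpart u))) / (?Q * ?Q)))) (at x)"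
    unfolding H_fun_def
    by (rule has_derivative_eq_rhs, rule has_derivative_mult_right, rule has_derivative_diff[OF M],
        rule has_derivative_divide'[OF has_derivative_power[OF has_derivative_sigma] has_derivative_quadratic_form])
      (use Q in \<open>auto simp: fun_eq_iff\<close>)
  also have "(\<lambda>u. 1/2 * (2 * ((A *v Mpart x) \<bullet> Mpart u) -
       ((2 * ?\<sigma> * ?d\<sigma> u) * ?Q - ?\<sigma>\<^sup>2 * (2 * ((A *v gpart x) \<bullet> gpart u))) / (?Q * ?Q))) =
     (\<lambda>u. (A *v Mpart x) \<bullet> Mpart u + S * ?d\<sigma> u + S\<^sup>2 * ((A *v gpart x) \<bullet> gpart u))"
    unfolding \<sigma> using Q by (auto simp: fun_eq_iff field_simps power2_eq_square)
  also have "\<dots> = (\<lambda>u. u \<bullet> join_vec (A *v Mpart x + S *\<^sub>R (A *v gpart x - gpart x))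
      (S *\<^sub>R (A *v Mpart x - Mpart x - k) + S\<^sup>2 *\<^sub>R (A *v gpart x)))"
    using matrix_symmetric[of "gpart x"]
    by (simp add: fun_eq_iff inner_eq_parts inner_add_right inner_diff_right inner_diff_left
        inner_commute algebra_simps)
  finally show ?thesis by (simp add: gderiv_def)
qed

lemma poisson_structure_P_fun: "poisson_structure phase_space (\<lambda>x. P_fun A k (Mpart x) (gpart x))"
proof -
  define P where "P x = P_fun A k (Mpart x) (gpart x)" for x
  define g where "g x = g_fun A (gpart x)" for x
  define S where "S x = S_fun A k (Mpart x) (gpart x)" for x
  define w where "w x = Mpart x + k - S x *\<^sub>R gpart x" for x
  define p where "p a b = Mpart b \<times> Mpart a" for a b
  define q where "q a b = gpart b \<times> Mpart a + Mpart b \<times> gpart a" for a b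
  define dg where "dg x u = ((A *v gpart x) \<bullet> gpart u) / g x" for x u
  define dS where "dS x u = - ((A *v Mpart u - Mpart u) \<bullet> gpart x
      + (A *v Mpart x - Mpart x - k) \<bullet> gpart u + 2 * S x * ((A *v gpart x) \<bullet> gpart u))
      / ((A *v gpart x) \<bullet> gpart x)" for x u
  \<comment> \<open>The product rule for \<open>g * (w \<bullet> p + \<gamma> \<bullet> q)\<close>
    with constant covectors, where \<open>w\<close> also varies through \<open>S\<close>.\<close>
  define T where "T x a b u = dg x u * (w x \<bullet> p a b + gpart x \<bullet> q a b)
      + g x * ((Mpart u - S x *\<^sub>R gpart u - dS x u *\<^sub>R gpart x) \<bullet> p a b + gpart u \<bullet> q a b)"
    for x a b u
  have P: "a \<bullet> (P x *v b) = g x * (w x \<bullet> p a b + gpart x \<bullet> q a b)" for a b x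
    by (simp add: P_def g_def w_def S_def p_def q_def inner_P_fun)
  have g_der: "(g has_derivative dg x) (at x)" if "x \<in> phase_space" for x
    using has_derivative_g_fun[OF that] by (simp add: g_def[abs_def] dg_def[abs_def])
  have S_der: "(S has_derivative dS x) (at x)" if "x \<in> phase_space" for x
    using has_derivative_S_fun[OF that] by (simp add: S_def[abs_def] dS_def[abs_def])
  have "poisson_structure phase_space P"
  proof (rule poisson_structureI[OF open_phase_space, where T = T])
    show "smooth_on phase_space (\<lambda>x. P x $ i $ j)" for i j
    proof -
      have "P x $ i $ j = axis i 1 \<bullet> (P x *v axis j 1)" for x
        by (simp add: inner_axis' matrix_vector_mul_component inner_axis)
      moreover have "smooth_on phase_space (\<lambda>x. axis i 1 \<bullet> (P x *v axis j 1))"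
        unfolding P w_def g_def S_def
        by (intro smooth_on_mult smooth_on_add smooth_on_g_fun smooth_on_inner_vec smooth_on_gpart smooth_on_const)
          (simp add: smooth_on_diff smooth_on_add smooth_on_mult smooth_on_S_fun smooth_on_gpart
            smooth_on_Mpart smooth_on_const)
      ultimately show ?thesis by simp
    qed
    show "a \<bullet> (P x *v b) = - (b \<bullet> (P x *v a))" for x a b
    proof -
      have "p a b = - p b a" "q a b = - q b a"
        unfolding p_def q_def by (simp_all add: cross_skew[of "Mpart b"] cross_skew[of "gpart b"])
      then show ?thesis unfolding P by (simp add: algebra_simps)
    qed
    show "((\<lambda>y. a \<bullet> (P y *v b)) has_derivative T x a b) (at x)" if x: "x \<in> phase_space" for x a b
      unfolding P w_def
      by (rule has_derivative_eq_rhs,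
          (rule has_derivative_mult has_derivative_add has_derivative_diff has_derivative_inner_left
            has_derivative_scaleR has_derivative_Mpart has_derivative_gpart has_derivative_ident
            has_derivative_const g_der[OF x] S_der[OF x])+)
        (simp add: fun_eq_iff T_def w_def algebra_simps)
    show "T x a b (P x *v c) + T x b c (P x *v a) + T x c a (P x *v b) = 0"
      if x: "x \<in> phase_space" for x a b c
    proof -
      define Q where "Q = (A *v gpart x) \<bullet> gpart x"
      define y where "y = A *v gpart x"
      define m where "m c = w x \<times> Mpart c + gpart x \<times> gpart c" for c
      have g: "g x > 0" "g x * g x = Q" and Q: "Q > 0"
        using g_fun_pos[OF x] quadratic_form_pos[OF x] by (simp_all add: g_def Q_def g_fun_def)
      have Pc: "P x *v c = g x *\<^sub>R join_vec (m c) (gpart x \<times> Mpart c)" for c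
        by (simp add: P_def P_fun_mult_vec g_def m_def w_def S_def)
      define n where "n c = gpart x \<times> Mpart c" for c
      \<comment> \<open>At \<open>P x *v c\<close> the square roots disappear: \<open>dg\<close>
        contributes \<open>g / g\<close>, the e(3) part carries \<open>g * g = Q\<close>, and the
        same factor cancels the denominator of \<open>dS\<close>.\<close>
      have T: "T x a b (P x *v c) =
          (y \<bullet> n c) * (w x \<bullet> p a b + gpart x \<bullet> q a b)
          + (m c \<bullet> y - m c \<bullet> gpart x + (A *v Mpart x - w x) \<bullet> n c + 2 * S x * (y \<bullet> n c))
            * (gpart x \<bullet> p a b)
          + Q * (m c \<bullet> p a b + n c \<bullet> q a b - S x * (n c \<bullet> p a b))" (is "_ = _ + ?X * _ + _")
        for a b c
      proof -
        \<comment> \<open>\<open>M + k\<close> and \<open>w x\<close> differ by a multiple of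
          \<gamma>, to which \<open>n c\<close> is orthogonal.\<close>
        have zn: "(A *v Mpart x - Mpart x - k) \<bullet> n c = (A *v Mpart x - w x) \<bullet> n c"
          by (simp add: w_def n_def inner_diff_left inner_add_left dot_cross_self)
        have Am: "(A *v m c - m c) \<bullet> gpart x = m c \<bullet> y - m c \<bullet> gpart x"
          using matrix_symmetric[of "m c" "gpart x"]
          by (simp add: inner_diff_left inner_diff_right y_def inner_commute)
        have dg: "dg x (P x *v c) = y \<bullet> n c"
          using g(1) by (simp add: dg_def Pc y_def n_def)
        have "dS x (P x *v c) = - (g x * ?X) / Q"
          unfolding dS_def Q_def y_def[symmetric] Pc parts_linear
            Mpart_join_vec gpart_join_vec n_def[symmetric] zn[symmetric] Am[symmetric]
          by (simp add: matrix_vector_mult_scaleR inner_diff_left algebra_simps)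
        then have "g x * dS x (P x *v c) = - (g x * g x * ?X / Q)"
          by simp
        then have dS: "g x * dS x (P x *v c) = - ?X"
          using Q unfolding g(2) by simp
        have "T x a b (P x *v c) = (y \<bullet> n c) * (w x \<bullet> p a b + gpart x \<bullet> q a b)
            + g x * g x * (m c \<bullet> p a b + n c \<bullet> q a b - S x * (n c \<bullet> p a b))
            - (g x * dS x (P x *v c)) * (gpart x \<bullet> p a b)"
          unfolding T_def dg by (simp add: Pc n_def inner_diff_left algebra_simps)
        then show ?thesis unfolding dS g(2) mult_minus_left by linarith
      qed
      have e3: "(m c \<bullet> p a b + n c \<bullet> q a b) + (m a \<bullet> p b c + n a \<bullet> q b c)
          + (m b \<bullet> p c a + n b \<bullet> q c a) = 0"
        unfolding m_def n_def p_def q_def by (rule e3_jacobi)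
      \<comment> \<open>The Jacobi identity of the cross product paired with \<gamma>; it removes
        the terms with \<open>- S x *\<^sub>R gpart x\<close>.\<close>
      have cr: "n c \<bullet> p a b + n a \<bullet> p b c + n b \<bullet> p c a = 0"
        unfolding n_def p_def by (simp add: dot_cross inner_commute)
      have "Q * (m c \<bullet> p a b + n c \<bullet> q a b - S x * (n c \<bullet> p a b))
          + Q * (m a \<bullet> p b c + n a \<bullet> q b c - S x * (n a \<bullet> p b c))
          + Q * (m b \<bullet> p c a + n b \<bullet> q c a - S x * (n b \<bullet> p c a))
        = Q * ((m c \<bullet> p a b + n c \<bullet> q a b) + (m a \<bullet> p b c + n a \<bullet> q b c)
          + (m b \<bullet> p c a + n b \<bullet> q c a)) - Q * S x * (n c \<bullet> p a b + n a \<bullet> p b c + n b \<bullet> p c a)"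
        by (simp add: algebra_simps)
      also have "\<dots> = 0" unfolding e3 cr by simp
      \<comment> \<open>The e(3) part is settled; the other summands form the cyclic sum of
        \<open>K\<close>, with \<open>r\<close> and \<open>s\<close> taken as
        \<open>A *v Mpart x\<close> and \<open>2 * S x\<close>.\<close>
      finally show ?thesis
        unfolding T
        using conformal_jacobi[of y "gpart x" "Mpart c" "w x" "Mpart b" "Mpart a" "gpart b" "gpart a"
            "gpart c" "A *v Mpart x" "2 * S x"]
        unfolding m_def n_def p_def q_def by linarith
    qed
  qed
  then show ?thesis by (simp add: P_def[abs_def])
qed

section \<open>Casimir functions and first integrals\<close>

lemma GDERIV_H_fun_partial:
  assumes "x \<in> phase_space"
  defines "D \<equiv> grad (\<lambda>y. H_fun A k (Mpart y) (gpart y)) x"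
  shows "grad (\<lambda>m. H_fun A k m (gpart x)) (Mpart x) = Mpart D"
    and "grad (\<lambda>c. H_fun A k (Mpart x) c) (gpart x) = gpart D"
  using GDERIV_partial[of "\<lambda>y. H_fun A k (Mpart y) (gpart y)" "Mpart x" "gpart x" D]
    smooth_on_imp_GDERIV[OF smooth_on_H_fun assms(1)]
  by (auto simp: D_def intro: grad_eq)

lemma veselova_field_eq:
  assumes "x \<in> phase_space"
  shows "veselova_field A k x = inverse (g_fun A (gpart x)) *\<^sub>R
    (P_fun A k (Mpart x) (gpart x) *v grad (\<lambda>y. H_fun A k (Mpart y) (gpart y)) x)"
  using g_fun_pos[OF assms]
  by (simp add: veselova_field_def Let_def GDERIV_H_fun_partial[OF assms] P_fun_mult_vec)

lemma conformally_hamiltonian_veselova: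
  "conformally_hamiltonian phase_space (veselova_field A k) (\<lambda>x. g_fun A (gpart x))
     (\<lambda>x. P_fun A k (Mpart x) (gpart x)) (\<lambda>x. H_fun A k (Mpart x) (gpart x))"
  unfolding conformally_hamiltonian_def
  using smooth_on_g_fun g_fun_pos poisson_structure_P_fun smooth_on_H_fun veselova_field_eq by blast

text \<open>Energy conservation by skewness: the quadratic form of \<open>P\<close> vanishes on the
  gradient of \<open>H\<close>.\<close>

lemma first_integral_H_fun:
  "first_integral phase_space (veselova_field A k) (\<lambda>x. H_fun A k (Mpart x) (gpart x))"
proof (rule first_integralI[OF smooth_on_H_fun])
  fix x assume "x \<in> phase_space"
  then show "grad (\<lambda>x. H_fun A k (Mpart x) (gpart x)) x \<bullet> veselova_field A k x = 0"
    by (simp add: veselova_field_eq inner_P_fun cross_refl inner_add_right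
        cross_skew[of "gpart (grad _ _)"])
qed

end

section \<open>The geometric integrals and the additional integral\<close>

lemma GDERIV_F1: "GDERIV (\<lambda>x. gpart x \<bullet> gpart x) x :> join_vec 0 (2 *\<^sub>R gpart x)"
  unfolding gderiv_def
  by (rule has_derivative_eq_rhs, rule has_derivative_inner,
      (rule has_derivative_gpart has_derivative_ident)+)
    (simp add: fun_eq_iff inner_eq_parts inner_commute)

lemma GDERIV_F2: "GDERIV (\<lambda>x. (Mpart x + k) \<bullet> gpart x) x :> join_vec (gpart x) (Mpart x + k)"
  unfolding gderiv_def
  by (rule has_derivative_eq_rhs, rule has_derivative_inner,
      (rule has_derivative_gpart has_derivative_Mpart has_derivative_add has_derivative_const
        has_derivative_ident)+)
    (simp add: fun_eq_iff inner_eq_parts inner_commute)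

lemma GDERIV_F3:
  "GDERIV (\<lambda>x. (Mpart x + k) \<bullet> (Mpart x + k)) x :> join_vec (2 *\<^sub>R (Mpart x + k)) 0"
  unfolding gderiv_def
  by (rule has_derivative_eq_rhs, rule has_derivative_inner,
      (rule has_derivative_Mpart has_derivative_add has_derivative_const has_derivative_ident)+)
    (simp add: fun_eq_iff inner_eq_parts inner_commute)

text \<open>The gradient has no \<open>M\<close> block, and its \<gamma> block is parallel to
  \<gamma>.\<close>

lemma casimir_F1:
  "casimir phase_space (\<lambda>x. P_fun A k (Mpart x) (gpart x)) (\<lambda>x. gpart x \<bullet> gpart x)"
  unfolding casimir_def
  by (auto simp: grad_eq[OF GDERIV_F1] P_fun_mult_vec cross_mult_right
      intro!: smooth_on_inner_vec smooth_on_gpart parts_eqI)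

text \<open>The term with \<open>S\<close> drops out because \<gamma> is crossed with itself; the
  two products of \<open>M + k\<close> and \<gamma> that remain are opposite.\<close>

lemma casimir_F2:
  "casimir phase_space (\<lambda>x. P_fun A k (Mpart x) (gpart x)) (\<lambda>x. (Mpart x + k) \<bullet> gpart x)"
proof -
  have "smooth_on phase_space (\<lambda>x. (Mpart x + k) \<bullet> gpart x)"
    by (intro smooth_on_inner_vec)
      (simp_all add: smooth_on_gpart smooth_on_add smooth_on_Mpart smooth_on_const)
  moreover have "P_fun A k (Mpart x) (gpart x) *v join_vec (gpart x) (Mpart x + k) = 0" for x
    by (rule parts_eqI) (simp_all add: P_fun_mult_vec Cross3.left_diff_distrib cross_mult_left
        cross_skew[of "gpart x" "Mpart x + k"])
  ultimately show ?thesis by (simp add: casimir_def grad_eq[OF GDERIV_F2])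
qed

text \<open>Makes the joint levels of the Casimir functions four-dimensional. Since \<gamma> is
  nonzero, the \<open>M\<close> block of a linear relation forces \<open>b = 0\<close>, and then the
  \<gamma> block forces \<open>a = 0\<close>.\<close>

lemma independent_F1_F2:
  "independent_functions phase_space (\<lambda>x. gpart x \<bullet> gpart x) (\<lambda>x. (Mpart x + k) \<bullet> gpart x)"
  unfolding independent_functions_def grad_eq[OF GDERIV_F1] grad_eq[OF GDERIV_F2]
proof (intro ballI allI impI)
  fix x a b
  assume x: "x \<in> phase_space"
    and eq: "a *\<^sub>R join_vec 0 (2 *\<^sub>R gpart x) + b *\<^sub>R join_vec (gpart x) (Mpart x + k) = 0"
  have "b *\<^sub>R gpart x = 0" "a *\<^sub>R 2 *\<^sub>R gpart x + b *\<^sub>R (Mpart x + k) = 0"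
    using arg_cong[OF eq, of Mpart] arg_cong[OF eq, of gpart] by simp_all
  with x show "a = 0 \<and> b = 0" by (auto simp: phase_space_def)
qed

text \<open>The \<open>M\<close> block of the field equals \<open>(M + k) \<times> \<omega>\<close>
  with \<open>\<omega> = A *v (M + S *\<^sub>R \<gamma>)\<close>, so the length of
  \<open>M + k\<close> is preserved. Unlike for the Casimir functions, this depends on the form of
  \<open>H\<close>.\<close>

lemma first_integral_F3:
  assumes "symmetric_pos_def A"
  shows "first_integral phase_space (veselova_field A k) (\<lambda>x. (Mpart x + k) \<bullet> (Mpart x + k))"
proof (rule first_integralI)
  show "smooth_on phase_space (\<lambda>x. (Mpart x + k) \<bullet> (Mpart x + k))"
    by (intro smooth_on_inner_vec)
      (simp_all add: smooth_on_add smooth_on_Mpart smooth_on_const)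
next
  fix x assume x: "x \<in> phase_space"
  define N where "N = Mpart x + k"
  define \<gamma> where "\<gamma> = gpart x"
  define S where "S = S_fun A k (Mpart x) (gpart x)"
  \<comment> \<open>With \<open>u\<close> and \<open>y\<close> standing for \<open>A *v M\<close>
    and \<open>A *v \<gamma>\<close>, all terms with \<gamma> cancel and the second factor becomes
    \<open>N \<times> (u + S *\<^sub>R y)\<close>.\<close>
  have "N \<bullet> ((N - S *\<^sub>R \<gamma>) \<times> (u + S *\<^sub>R (y - \<gamma>)) + \<gamma> \<times> (S *\<^sub>R (u - N) + S\<^sup>2 *\<^sub>R y)) = 0" for u y
    by (simp add: cross3_simps power2_eq_square)
  from this[of "A *v Mpart x" "A *v gpart x"]
  show "grad (\<lambda>x. (Mpart x + k) \<bullet> (Mpart x + k)) x \<bullet> veselova_field A k x = 0"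
    by (simp add: veselova_field_eq[OF assms x] grad_eq[OF GDERIV_F3] P_fun_mult_vec
        grad_eq[OF GDERIV_H_fun[OF assms x]] inner_eq_parts N_def \<gamma>_def S_def diff_diff_eq)
qed

theorem mainTheorem3:
  fixes A :: "real^3^3" and k :: "real^3"
    and v :: "real^(3 + 3) \<Rightarrow> real^(3 + 3)"
    and P :: "real^(3 + 3) \<Rightarrow> real^(3 + 3)^(3 + 3)"
    and H g F\<^sub>1 F\<^sub>2 F\<^sub>3 :: "real^(3 + 3) \<Rightarrow> real"
  assumes "symmetric_pos_def A"
  defines "v \<equiv> veselova_field A k"
    and "P \<equiv> (\<lambda>x. P_fun A k (Mpart x) (gpart x))"
    and "H \<equiv> (\<lambda>x. H_fun A k (Mpart x) (gpart x))"
    and "g \<equiv> (\<lambda>x. g_fun A (gpart x))"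
    and "F\<^sub>1 \<equiv> (\<lambda>x. gpart x \<bullet> gpart x)"
    and "F\<^sub>2 \<equiv> (\<lambda>x. (Mpart x + k) \<bullet> gpart x)"
    and "F\<^sub>3 \<equiv> (\<lambda>x. (Mpart x + k) \<bullet> (Mpart x + k))"
  shows "conformally_hamiltonian phase_space v g P H \<and>
    casimir phase_space P F\<^sub>1 \<and> casimir phase_space P F\<^sub>2 \<and>
    independent_functions phase_space F\<^sub>1 F\<^sub>2 \<and>
    first_integral phase_space v H \<and> first_integral phase_space v F\<^sub>3"
  unfolding assms(2-)
  using conformally_hamiltonian_veselova casimir_F1 casimir_F2 independent_F1_F2
    first_integral_H_fun first_integral_F3 assms(1) by blast

end
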